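(* Let $H$ be a connected hypergraph with a cut edge $f$. Let $H_i$, for $i\in I$, be the connected components of $H\setminus f$. Then: (1) $H$ has an Euler family if and only if there exists $i\in I$ such that $H[V(H_i)]$ has a non-empty Euler family and $H_j$ has an Euler family for all $j\neq i$; likewise, $H$ has a spanning Euler family if and only if there exists $i\in I$ such that $H[V(H_i)]$ has a non-empty spanning Euler family and $H_j$ has a spanning Euler family for all $j\neq i$. (2) $H$ has an Euler tour if and only if there exists $i\in I$ such that $H[V(H_i)]$ has an Euler tour and $H_j$ is empty (edgeless) for all $j\neq i$. (3) $H$ has no spanning Euler tour.
   Context: A hypergraph $H=(V,E)$ has a non-empty finite vertex set $V$ and a finite collection $E$ of edges, each associated with a subset of $V$; parallel edges are allowed, so $E$ is a multiset of subsets of $V$. A walk is a sequence $v_0e_1v_1\dots v_{r-1}e_rv_r$ ($r\ge 0$) with $v_{i-1}\ne v_i$ and $v_{i-1},v_i\in e_i$ for all $i=1,\dots,r$; its anchors are $v_0,\dots,v_r$; it is closed if $v_0=v_r$, trivial if $r=0$, and a strict trail if its edges are pairwise distinct. $H$ is connected if any two vertices are joined by a walk; the connected components of $H$ are its maximal connected subhypergraphs $(V',E')$ with $V'\subseteq V$, $E'\subseteq E$, having no empty edges; $c(H)$ is the number of them. $H\setminus f=(V,E\setminus\{f\})$, and $f\in E$ is a cut edge if $c(H\setminus f)>c(H)$. For $V'\subseteq V$, the induced subhypergraph $H[V']$ has vertex set $V'$ and edge multiset $\{e\cap V': e\in E,\ e\cap V'\neq\emptyset\}$ (one edge for each such $e$).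 An Euler tour of $H$ is a closed strict trail traversing every edge of $H$ exactly once. An Euler family of $H$ is a collection of pairwise edge-disjoint, pairwise anchor-disjoint non-trivial closed strict trails of $H$ jointly traversing every edge of $H$ exactly once (an edgeless hypergraph has the empty Euler family). An Euler tour or Euler family is spanning if every vertex of $H$ is an anchor of it (of one of its trails).
   Formalization: Parts (1) and (2) are stated for hypergraphs without empty edges: an empty edge is dropped by components and induced subhypergraphs but can never be traversed, so the "if" directions fail when one is present; part (3) is unrestricted. *)

theory Defs
  imports Main
begin

(* Edges are named objects; "incidence" gives the vertex subset associated with an edge.
   Distinct edges with the same incident set are parallel. *)
record ('v, 'e) hypergraph =
  verts :: "'v set"
  edges :: "'e set"
  incidence :: "'e \<Rightarrow> 'v set"

definition is_hypergraph :: "('v, 'e) hypergraph \<Rightarrow> bool" where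
  "is_hypergraph H \<longleftrightarrow>
     finite (verts H) \<and> verts H \<noteq> {} \<and> finite (edges H) \<and>
     (\<forall>e\<in>edges H. incidence H e \<subseteq> verts H)"

(* Empty edges are allowed in general: they do not affect connectedness and are dropped by
   components and induced subhypergraphs. But no walk traverses one, so a hypergraph with an
   empty edge has no Euler tour or Euler family. *)
definition no_empty_edges :: "('v, 'e) hypergraph \<Rightarrow> bool" where
  "no_empty_edges H \<longleftrightarrow> (\<forall>e\<in>edges H. incidence H e \<noteq> {})"

(* The sequence v_0 e_1 v_1 ... e_r v_r is the pair ([v_0, ..., v_r], [e_1, ..., e_r]). *)
type_synonym ('v, 'e) walk = "'v list \<times> 'e list"

definition walk_anchors :: "('v, 'e) walk \<Rightarrow> 'v set" where
  "walk_anchors W = set (fst W)"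

definition walk_edges :: "('v, 'e) walk \<Rightarrow> 'e set" where
  "walk_edges W = set (snd W)"

definition is_walk :: "('v, 'e) hypergraph \<Rightarrow> ('v, 'e) walk \<Rightarrow> bool" where
  "is_walk H W \<longleftrightarrow> (case W of (vs, es) \<Rightarrow>
     length vs = Suc (length es) \<and> set vs \<subseteq> verts H \<and> set es \<subseteq> edges H \<and>
     (\<forall>i<length es. vs ! i \<noteq> vs ! Suc i \<and>
        vs ! i \<in> incidence H (es ! i) \<and> vs ! Suc i \<in> incidence H (es ! i)))"

definition closed_walk :: "('v, 'e) walk \<Rightarrow> bool" where
  "closed_walk W \<longleftrightarrow> hd (fst W) = last (fst W)"

definition trivial_walk :: "('v, 'e) walk \<Rightarrow> bool" where
  "trivial_walk W \<longleftrightarrow> snd W = []"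

definition strict_trail :: "('v, 'e) hypergraph \<Rightarrow> ('v, 'e) walk \<Rightarrow> bool" where
  "strict_trail H W \<longleftrightarrow> is_walk H W \<and> distinct (snd W)"

definition connected_hypergraph :: "('v, 'e) hypergraph \<Rightarrow> bool" where
  "connected_hypergraph H \<longleftrightarrow>
     (\<forall>u\<in>verts H. \<forall>v\<in>verts H. \<exists>W. is_walk H W \<and> hd (fst W) = u \<and> last (fst W) = v)"

(* The incidence functions are required to agree everywhere, so that a subhypergraph is
   determined by its vertex and edge sets. *)
definition subhypergraph :: "('v, 'e) hypergraph \<Rightarrow> ('v, 'e) hypergraph \<Rightarrow> bool" where
  "subhypergraph H' H \<longleftrightarrow>
     is_hypergraph H' \<and> verts H' \<subseteq> verts H \<and> edges H' \<subseteq> edges H \<and>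
     incidence H' = incidence H"

definition components :: "('v, 'e) hypergraph \<Rightarrow> ('v, 'e) hypergraph set" where
  "components H =
     {C. subhypergraph C H \<and> connected_hypergraph C \<and> no_empty_edges C \<and>
         (\<forall>D. subhypergraph D H \<and> connected_hypergraph D \<and> no_empty_edges D \<and>
              subhypergraph C D \<longrightarrow> D = C)}"

definition num_components :: "('v, 'e) hypergraph \<Rightarrow> nat" where
  "num_components H = card (components H)"

definition delete_edge :: "('v, 'e) hypergraph \<Rightarrow> 'e \<Rightarrow> ('v, 'e) hypergraph" where
  "delete_edge H f = H\<lparr>edges := edges H - {f}\<rparr>"

definition cut_edge :: "('v, 'e) hypergraph \<Rightarrow> 'e \<Rightarrow> bool" where
  "cut_edge H f \<longleftrightarrow> f \<in> edges H \<and> num_components (delete_edge H f) > num_components H"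

(* The edge of the induced subhypergraph arising from e keeps the name e. *)
definition induced :: "('v, 'e) hypergraph \<Rightarrow> 'v set \<Rightarrow> ('v, 'e) hypergraph" where
  "induced H V' =
     \<lparr>verts = V', edges = {e \<in> edges H. incidence H e \<inter> V' \<noteq> {}},
      incidence = (\<lambda>e. incidence H e \<inter> V')\<rparr>"

(* "Exactly once": strictness of a trail rules out repeated traversal. The trivial walk is
   an Euler tour of an edgeless hypergraph. *)
definition euler_tour :: "('v, 'e) hypergraph \<Rightarrow> ('v, 'e) walk \<Rightarrow> bool" where
  "euler_tour H T \<longleftrightarrow> strict_trail H T \<and> closed_walk T \<and> walk_edges T = edges H"

definition spanning_euler_tour :: "('v, 'e) hypergraph \<Rightarrow> ('v, 'e) walk \<Rightarrow> bool" where
  "spanning_euler_tour H T \<longleftrightarrow> euler_tour H T \<and> walk_anchors T = verts H"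

definition euler_family :: "('v, 'e) hypergraph \<Rightarrow> ('v, 'e) walk set \<Rightarrow> bool" where
  "euler_family H F \<longleftrightarrow>
     (\<forall>T\<in>F. strict_trail H T \<and> closed_walk T \<and> \<not> trivial_walk T) \<and>
     pairwise (\<lambda>S T. disjnt (walk_edges S) (walk_edges T)) F \<and>
     pairwise (\<lambda>S T. disjnt (walk_anchors S) (walk_anchors T)) F \<and>
     (\<Union>T\<in>F. walk_edges T) = edges H"

definition spanning_euler_family :: "('v, 'e) hypergraph \<Rightarrow> ('v, 'e) walk set \<Rightarrow> bool" where
  "spanning_euler_family H F \<longleftrightarrow>
     euler_family H F \<and> (\<Union>T\<in>F. walk_anchors T) = verts H"

end

theory Submission
  imports Defs
begin

text \<open>
  The idea is that a closed strict trail cannot cross a cut edge \<open>f\<close>: it may use \<open>f\<close> only once, so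
  after removing \<open>f\<close> the rest of the closed trail still links all of its anchors, in particular the
  two anchors between which \<open>f\<close> was traversed.  Hence the anchors of every closed strict trail of \<open>H\<close>
  lie in the vertex set of a single connected component of \<open>H \ f\<close>
  (\<open>closed_strict_trail_linked_without_edge\<close>, \<open>closed_strict_trail_in_one_component\<close>).

  Every edge other than \<open>f\<close> has all of its vertices in one component, whereas \<open>f\<close> meets all
  components, because \<open>H\<close> is connected.  So \<open>H\<close> may be split along the components, and the trail
  through \<open>f\<close> determines the one component \<open>H\<^sub>i\<close> in which \<open>f\<close>, cut down to \<open>f \<inter> V(H\<^sub>i)\<close>, has to be
  kept.  A walk of \<open>H[V(H\<^sub>i)]\<close> is a walk of \<open>H\<close> with anchors in \<open>V(H\<^sub>i)\<close>, and a walk of \<open>H\<^sub>j\<close> is in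
  addition one that avoids \<open>f\<close>; thus sorting the trails of a family of \<open>H\<close> by the component that
  they live in, and taking unions of families of the components, are mutually inverse operations.
  They preserve the set of anchors, which gives the spanning version as well.

  Every edge traversed by a tour meets the component that contains the anchors of the tour, so the
  other components are edgeless; and as there are at least two components, the anchors of a tour
  never exhaust the vertices.
\<close>

section \<open>Walks and linked vertices\<close>

text \<open>
  The reflexive transitive closure of sharing an edge: it holds between the ends of any walk, yet
  its symmetry and transitivity need no reversal or concatenation of vertex and edge lists, nor the
  side condition that consecutive anchors of a walk differ.
\<close>
definition linked :: "('v, 'e) hypergraph \<Rightarrow> ('v \<times> 'v) set" where
  "linked G = {(u, v). \<exists>e\<in>edges G. u \<in> incidence G e \<and> v \<in> incidence G e}\<^sup>*"

lemma linked_refl [simp]: "(u, u) \<in> linked G"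
  by (simp add: linked_def)

lemma linked_trans: "(u, v) \<in> linked G \<Longrightarrow> (v, w) \<in> linked G \<Longrightarrow> (u, w) \<in> linked G"
  unfolding linked_def by (rule rtrancl_trans)

lemma linked_sym: "(u, v) \<in> linked G \<Longrightarrow> (v, u) \<in> linked G"
  unfolding linked_def by (rule symD[OF sym_rtrancl]) (auto simp: sym_def)

lemma linked_by_edge:
  "e \<in> edges G \<Longrightarrow> u \<in> incidence G e \<Longrightarrow> v \<in> incidence G e \<Longrightarrow> (u, v) \<in> linked G"
  unfolding linked_def by (rule r_into_rtrancl) blast

lemma linked_mono:
  assumes "edges G \<subseteq> edges G'" "incidence G = incidence G'"
  shows "linked G \<subseteq> linked G'"
  unfolding linked_def by (rule rtrancl_mono) (use assms in auto)

text \<open>A set of vertices that no edge crosses cannot be left along edges.\<close>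
lemma linked_closed_set:
  assumes "(u, v) \<in> linked G" "u \<in> S"
    and "\<And>e. e \<in> edges G \<Longrightarrow> incidence G e \<inter> S \<noteq> {} \<Longrightarrow> incidence G e \<subseteq> S"
  shows "v \<in> S"
  using assms(1) unfolding linked_def
  by (induction rule: rtrancl_induct) (use assms(2,3) in blast)+

text \<open>
  The edges of the segment are required to lie in a second hypergraph \<open>G\<close>, so that the segments of
  a walk of \<open>H\<close> that avoid a given edge can be transferred to \<open>H\<close> without that edge.
\<close>
lemma walk_segment_linked:
  assumes "is_walk H (vs, es)" "i \<le> j" "j \<le> length es"
    and "\<And>k. i \<le> k \<Longrightarrow> k < j \<Longrightarrow> es ! k \<in> edges G"
    and "incidence G = incidence H"
  shows "(vs ! i, vs ! j) \<in> linked G"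
  using assms(2,3,4)
proof (induction j rule: dec_induct)
  case base
  show ?case by simp
next
  case (step n)
  have "(vs ! n, vs ! Suc n) \<in> linked G"
  proof (rule linked_by_edge)
    show "es ! n \<in> edges G" using step.prems(2)[of n] step.hyps by simp
    show "vs ! n \<in> incidence G (es ! n)" "vs ! Suc n \<in> incidence G (es ! n)"
      using assms(1,5) step.prems(1) by (auto simp: is_walk_def)
  qed
  moreover have "(vs ! i, vs ! n) \<in> linked G"
    using step by simp
  ultimately show ?case by (rule linked_trans[rotated])
qed

lemma linked_imp_walk:
  assumes "is_hypergraph G" "(u, v) \<in> linked G" "v \<in> verts G"
  shows "\<exists>W. is_walk G W \<and> hd (fst W) = u \<and> last (fst W) = v"
  using assms(2) unfolding linked_def
proof (induction rule: converse_rtrancl_induct)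
  case base
  show ?case
    using assms(3) by (intro exI[of _ "([v], [])"]) (simp add: is_walk_def)
next
  case (step u w)
  \<comment> \<open>Two vertices that share an edge may coincide, and then nothing is put in front of the walk.\<close>
  then obtain e vs es where e: "e \<in> edges G" "u \<in> incidence G e" "w \<in> incidence G e"
    and W: "is_walk G (vs, es)" "hd vs = w" "last vs = v" by auto
  show ?case
  proof (cases "u = w")
    case True
    then show ?thesis using W by (intro exI[of _ "(vs, es)"]) simp
  next
    case False
    have "u \<in> verts G" using e assms(1) by (auto simp: is_hypergraph_def)
    moreover have "vs \<noteq> []" using W(1) by (auto simp: is_walk_def)
    ultimately have "is_walk G (u # vs, e # es)"
      using W(1,2) e False by (auto simp: is_walk_def nth_Cons hd_conv_nth split: nat.splits)
    then show ?thesis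
      using W(3) \<open>vs \<noteq> []\<close> by (intro exI[of _ "(u # vs, e # es)"]) simp
  qed
qed

lemma connected_hypergraph_iff_linked:
  assumes "is_hypergraph G"
  shows "connected_hypergraph G \<longleftrightarrow> (\<forall>u\<in>verts G. \<forall>v\<in>verts G. (u, v) \<in> linked G)"
proof -
  have "(u, v) \<in> linked G" if "is_walk G W" "hd (fst W) = u" "last (fst W) = v" for u v W
  proof -
    obtain vs es where W: "W = (vs, es)" by (cases W)
    have *: "length vs = Suc (length es)" "set es \<subseteq> edges G"
      using that(1) W by (auto simp: is_walk_def)
    then have "vs \<noteq> []" by auto
    have "(vs ! 0, vs ! length es) \<in> linked G"
      using that(1) * unfolding W by (intro walk_segment_linked[of G vs es]) auto
    then show ?thesis
      using that * \<open>vs \<noteq> []\<close> by (simp add: W hd_conv_nth last_conv_nth)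
  qed
  then show ?thesis
    unfolding connected_hypergraph_def using linked_imp_walk[OF assms] by blast
qed

lemma walk_anchors_nonempty: "is_walk H T \<Longrightarrow> walk_anchors T \<noteq> {}"
  by (auto simp: is_walk_def walk_anchors_def)

lemma walk_anchors_subset: "is_walk H T \<Longrightarrow> walk_anchors T \<subseteq> verts H"
  by (auto simp: is_walk_def walk_anchors_def)

lemma walk_edges_subset: "is_walk H T \<Longrightarrow> walk_edges T \<subseteq> edges H"
  by (auto simp: is_walk_def walk_edges_def)

lemma walk_edge_meets_anchors:
  assumes "is_walk H T" "e \<in> walk_edges T"
  shows "incidence H e \<inter> walk_anchors T \<noteq> {}"
proof -
  obtain vs es where T: "T = (vs, es)" by (cases T)
  obtain i where "i < length es" "es ! i = e"
    using assms(2) T by (auto simp: walk_edges_def in_set_conv_nth)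
  then have "vs ! i \<in> incidence H e" "vs ! i \<in> set vs"
    using assms(1) T by (auto simp: is_walk_def)
  then show ?thesis using T by (auto simp: walk_anchors_def)
qed

text \<open>
  The edge \<open>f\<close> occurs at most once.  An anchor before that occurrence is reached from the start of
  the trail without \<open>f\<close>; from an anchor after it, the end of the trail, which is the start, is
  reached without \<open>f\<close>.
\<close>
lemma closed_strict_trail_linked_without_edge:
  assumes "strict_trail H T" "closed_walk T" "u \<in> walk_anchors T" "v \<in> walk_anchors T"
  shows "(u, v) \<in> linked (delete_edge H f)"
proof -
  let ?G = "delete_edge H f"
  obtain vs es where T: "T = (vs, es)" by (cases T)
  have walk: "is_walk H (vs, es)" and dist: "distinct es"
    using assms(1) T by (auto simp: strict_trail_def)
  have len: "length vs = Suc (length es)" and es: "set es \<subseteq> edges H"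
    using walk by (auto simp: is_walk_def)
  have "vs \<noteq> []" using len by auto
  then have closed: "vs ! length es = vs ! 0"
    using assms(2) T len by (simp add: closed_walk_def hd_conv_nth last_conv_nth)
  have segment: "(vs ! i, vs ! j) \<in> linked ?G"
    if "i \<le> j" "j \<le> length es" "\<And>k. i \<le> k \<Longrightarrow> k < j \<Longrightarrow> es ! k \<noteq> f" for i j
    using that es by (intro walk_segment_linked[OF walk])
      (auto simp: delete_edge_def subset_iff)
  have from_start: "(vs ! 0, vs ! i) \<in> linked ?G" if i: "i \<le> length es" for i
  proof (cases "\<exists>k<i. es ! k = f")
    case False
    then show ?thesis using i segment[of 0 i] by auto
  next
    case True
    then obtain k where k: "k < i" "es ! k = f" by auto
    have "es ! l \<noteq> f" if "i \<le> l" "l < length es" for l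
      using that k i dist by (auto simp: nth_eq_iff_index_eq)
    then have "(vs ! i, vs ! length es) \<in> linked ?G"
      using i by (intro segment) auto
    then show ?thesis using closed linked_sym by metis
  qed
  obtain i j where "i \<le> length es" "j \<le> length es" "u = vs ! i" "v = vs ! j"
    using assms(3,4) T len by (auto simp: walk_anchors_def in_set_conv_nth less_Suc_eq_le)
  then show ?thesis using from_start linked_sym linked_trans by metis
qed

section \<open>Connected components\<close>

definition cell :: "('v, 'e) hypergraph \<Rightarrow> 'v \<Rightarrow> 'v set" where
  "cell G v = {u \<in> verts G. (v, u) \<in> linked G}"

text \<open>
  The only candidate for a component containing \<open>v\<close>: an edge that meets the cell of \<open>v\<close> lies inside
  it, so every edge that meets it must belong to the component, and meeting it excludes empty edges.
\<close>
definition component_at :: "('v, 'e) hypergraph \<Rightarrow> 'v \<Rightarrow> ('v, 'e) hypergraph" where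
  "component_at G v =
     \<lparr>verts = cell G v, edges = {e \<in> edges G. incidence G e \<inter> cell G v \<noteq> {}},
      incidence = incidence G\<rparr>"

lemma edge_within_cell:
  assumes "is_hypergraph G" "e \<in> edges G" "incidence G e \<inter> cell G v \<noteq> {}"
  shows "incidence G e \<subseteq> cell G v"
proof
  fix x assume x: "x \<in> incidence G e"
  obtain y where "y \<in> incidence G e" "(v, y) \<in> linked G"
    using assms(3) by (auto simp: cell_def)
  then have "(v, x) \<in> linked G"
    using x linked_by_edge[OF assms(2)] linked_trans by metis
  then show "x \<in> cell G v"
    using x assms(1,2) by (auto simp: cell_def is_hypergraph_def)
qed

lemma component_at_subhypergraph:
  assumes "is_hypergraph G" "v \<in> verts G"
  shows "subhypergraph (component_at G v) G"
proof -
  have "v \<in> cell G v" using assms(2) by (simp add: cell_def)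
  moreover have "cell G v \<subseteq> verts G" by (auto simp: cell_def)
  ultimately show ?thesis
    using assms(1) edge_within_cell[OF assms(1)]
    by (auto simp: subhypergraph_def component_at_def is_hypergraph_def
        intro: finite_subset dest: subsetD)
qed

text \<open>
  The links between \<open>v\<close> and the other vertices of its cell use only edges of the cell, because the
  vertices linked to \<open>v\<close> inside \<open>component_at G v\<close> form a set that no edge of \<open>G\<close> crosses.
\<close>
lemma component_at_connected:
  assumes "is_hypergraph G" "v \<in> verts G"
  shows "connected_hypergraph (component_at G v)"
proof -
  let ?D = "component_at G v"
  have D: "is_hypergraph ?D"
    using component_at_subhypergraph[OF assms] by (simp add: subhypergraph_def)
  have linked_D: "(v, u) \<in> linked ?D" if "u \<in> cell G v" for u
  proof -
    let ?S = "{u \<in> cell G v. (v, u) \<in> linked ?D}"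
    have "incidence G e \<subseteq> ?S" if e: "e \<in> edges G" "incidence G e \<inter> ?S \<noteq> {}" for e
    proof -
      have sub: "incidence G e \<subseteq> cell G v"
        using e by (intro edge_within_cell[OF assms(1)]) auto
      obtain y where y: "y \<in> incidence G e" "y \<in> cell G v" "(v, y) \<in> linked ?D"
        using e by auto
      have "(y, x) \<in> linked ?D" if "x \<in> incidence G e" for x
        using that e y by (intro linked_by_edge[of e]) (auto simp: component_at_def)
      then show ?thesis using sub linked_trans[OF y(3)] by blast
    qed
    moreover have "(v, u) \<in> linked G" "v \<in> ?S"
      using that assms(2) by (auto simp: cell_def)
    ultimately have "u \<in> ?S" by (intro linked_closed_set[of v u G ?S]) auto
    then show ?thesis by simp
  qed
  have "(u, w) \<in> linked ?D" if "u \<in> cell G v" "w \<in> cell G v" for u w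
    by (rule linked_trans[OF linked_sym[OF linked_D[OF that(1)]] linked_D[OF that(2)]])
  then show ?thesis
    unfolding connected_hypergraph_iff_linked[OF D] by (simp add: component_at_def)
qed

lemma component_at_no_empty_edges: "no_empty_edges (component_at G v)"
  by (auto simp: no_empty_edges_def component_at_def)

text \<open>Thus \<open>component_at G v\<close> is the largest candidate, which gives its maximality and uniqueness.\<close>
lemma connected_subhypergraph_component_at:
  assumes "is_hypergraph G" "subhypergraph E G" "connected_hypergraph E" "no_empty_edges E"
    and "v \<in> verts E"
  shows "subhypergraph E (component_at G v)"
proof -
  have E: "is_hypergraph E" "verts E \<subseteq> verts G" "edges E \<subseteq> edges G" "incidence E = incidence G"
    using assms(2) by (auto simp: subhypergraph_def)
  have V: "verts E \<subseteq> cell G v"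
    using assms(3,5) E linked_mono[OF E(3,4)]
    by (auto simp: connected_hypergraph_iff_linked[OF E(1)] cell_def)
  have "incidence G e \<inter> cell G v \<noteq> {}" if "e \<in> edges E" for e
  proof -
    have "incidence E e \<noteq> {}" "incidence E e \<subseteq> verts E"
      using that assms(4) E(1) by (auto simp: no_empty_edges_def is_hypergraph_def)
    then show ?thesis using V E(4) by auto
  qed
  then show ?thesis
    using E V by (auto simp: subhypergraph_def component_at_def)
qed

lemma subhypergraph_antisym: "subhypergraph A B \<Longrightarrow> subhypergraph B A \<Longrightarrow> A = B"
  by (auto simp: subhypergraph_def intro: hypergraph.equality)

lemma components_eq_component_at:
  assumes "is_hypergraph G"
  shows "components G = component_at G ` verts G"
proof (intro equalityI subsetI)
  fix K assume K: "K \<in> components G"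
  then have "is_hypergraph K" "verts K \<subseteq> verts G"
    by (auto simp: components_def subhypergraph_def)
  then obtain v where v: "v \<in> verts K" "v \<in> verts G"
    by (auto simp: is_hypergraph_def)
  have "subhypergraph K (component_at G v)"
    using K v by (intro connected_subhypergraph_component_at[OF assms]) (auto simp: components_def)
  then have "component_at G v = K"
    using K component_at_subhypergraph[OF assms v(2)] component_at_connected[OF assms v(2)]
      component_at_no_empty_edges[of G v] by (simp add: components_def)
  then show "K \<in> component_at G ` verts G" using v by auto
next
  fix K assume "K \<in> component_at G ` verts G"
  then obtain v where v: "v \<in> verts G" "K = component_at G v" by auto
  have "D = K" if D: "subhypergraph D G" "connected_hypergraph D" "no_empty_edges D"
    "subhypergraph K D" for D
  proof -
    have "v \<in> verts D"
      using D(4) v by (auto simp: subhypergraph_def component_at_def cell_def)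
    then have "subhypergraph D K"
      using connected_subhypergraph_component_at[OF assms D(1-3)] v(2) by simp
    then show ?thesis using D(4) by (rule subhypergraph_antisym)
  qed
  then show "K \<in> components G"
    using component_at_subhypergraph[OF assms v(1)] component_at_connected[OF assms v(1)]
      component_at_no_empty_edges[of G v] v(2) by (simp add: components_def)
qed

section \<open>Splitting along a cut edge\<close>

lemma pairwise_disjnt_UN:
  assumes "\<And>j. j \<in> J \<Longrightarrow> pairwise (\<lambda>S T. disjnt (g S) (g T)) (\<F> j)"
    and "\<And>j k S T x. j \<in> J \<Longrightarrow> k \<in> J \<Longrightarrow> S \<in> \<F> j \<Longrightarrow> T \<in> \<F> k \<Longrightarrow>
      x \<in> g S \<Longrightarrow> x \<in> g T \<Longrightarrow> j = k"
  shows "pairwise (\<lambda>S T. disjnt (g S) (g T)) (\<Union>j\<in>J. \<F> j)"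
proof (rule pairwiseI)
  fix S T assume "S \<in> (\<Union>j\<in>J. \<F> j)" "T \<in> (\<Union>j\<in>J. \<F> j)" and ST: "S \<noteq> T"
  then obtain j k where jk: "j \<in> J" "k \<in> J" "S \<in> \<F> j" "T \<in> \<F> k" by auto
  show "disjnt (g S) (g T)"
  proof (cases "j = k")
    case True
    then show ?thesis using pairwiseD[OF assms(1)[OF jk(1)] jk(3)] jk(4) ST by simp
  next
    case False
    then show ?thesis using assms(2)[OF jk] by (meson disjnt_iff)
  qed
qed

locale connected_with_cut_edge =
  fixes H :: "('v, 'e) hypergraph" and f :: 'e
    and I :: "'i set" and C :: "'i \<Rightarrow> ('v, 'e) hypergraph"
  assumes hyper: "is_hypergraph H"
    and conn: "connected_hypergraph H"
    and cut: "cut_edge H f"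
    and enum: "bij_betw C I (components (delete_edge H f))"
begin

abbreviation "V i \<equiv> verts (C i)"

lemma f_edge: "f \<in> edges H"
  using cut by (simp add: cut_edge_def)

lemma hyper_delete: "is_hypergraph (delete_edge H f)"
  using hyper by (auto simp: is_hypergraph_def delete_edge_def)

lemma component_images: "C ` I = component_at (delete_edge H f) ` verts H"
  using enum components_eq_component_at[OF hyper_delete]
  by (simp add: bij_betw_def delete_edge_def)

lemma component_form:
  assumes "i \<in> I"
  obtains v where "v \<in> verts H" "C i = component_at (delete_edge H f) v"
  using component_images assms by blast

lemma component_edges:
  "i \<in> I \<Longrightarrow> edges (C i) = {e \<in> edges H - {f}. incidence H e \<inter> V i \<noteq> {}}"
  by (erule component_form) (simp add: component_at_def delete_edge_def)

lemma component_incidence: "i \<in> I \<Longrightarrow> incidence (C i) = incidence H"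
  by (erule component_form) (simp add: component_at_def delete_edge_def)

lemma component_verts_subset: "i \<in> I \<Longrightarrow> V i \<subseteq> verts H"
  by (erule component_form) (auto simp: component_at_def delete_edge_def cell_def)

lemma component_verts_linked:
  assumes "i \<in> I" "u \<in> V i" "(u, w) \<in> linked (delete_edge H f)" "w \<in> verts H"
  shows "w \<in> V i"
proof (rule component_form[OF assms(1)])
  fix v assume "C i = component_at (delete_edge H f) v"
  then have "V i = {x \<in> verts H. (v, x) \<in> linked (delete_edge H f)}"
    by (simp add: component_at_def cell_def delete_edge_def)
  then show ?thesis using assms(2,4) linked_trans[OF _ assms(3)] by simp
qed

lemma edge_within_component:
  assumes "i \<in> I" "e \<in> edges H" "e \<noteq> f" "incidence H e \<inter> V i \<noteq> {}"
  shows "incidence H e \<subseteq> V i"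
proof (rule component_form[OF assms(1)])
  fix v assume "C i = component_at (delete_edge H f) v"
  then show ?thesis
    using edge_within_cell[OF hyper_delete, of e v] assms(2-4)
    by (simp add: component_at_def delete_edge_def)
qed

lemma component_verts_cover: "v \<in> verts H \<Longrightarrow> \<exists>i\<in>I. v \<in> V i"
proof -
  assume v: "v \<in> verts H"
  then obtain i where "i \<in> I" "C i = component_at (delete_edge H f) v"
    using component_images by (metis imageE imageI)
  then show ?thesis
    using v by (intro bexI[of _ i]) (simp_all add: component_at_def cell_def delete_edge_def)
qed

lemma component_verts_disjoint:
  assumes "i \<in> I" "j \<in> I" "v \<in> V i" "v \<in> V j"
  shows "i = j"
proof -
  obtain a b where a: "C i = component_at (delete_edge H f) a"
    and b: "C j = component_at (delete_edge H f) b"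
    using assms(1,2) component_form by metis
  have "(a, v) \<in> linked (delete_edge H f)" "(b, v) \<in> linked (delete_edge H f)"
    using assms(3,4) a b by (auto simp: component_at_def cell_def)
  then have "(a, u) \<in> linked (delete_edge H f) \<longleftrightarrow> (b, u) \<in> linked (delete_edge H f)" for u
    by (metis linked_sym linked_trans)
  then have "cell (delete_edge H f) a = cell (delete_edge H f) b"
    by (simp add: cell_def)
  then have "C i = C j" by (simp add: a b component_at_def)
  then show ?thesis using enum assms(1,2) by (auto simp: bij_betw_def inj_on_def)
qed

lemma component_nonempty: "i \<in> I \<Longrightarrow> V i \<noteq> {}"
  by (erule component_form) (auto simp: component_at_def delete_edge_def cell_def)

text \<open>
  \<open>H\<close> itself has a component, having a vertex; removing the cut edge increases the number.
\<close>
lemma other_component: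
  obtains j where "j \<in> I" "j \<noteq> i"
proof -
  have "finite (components H)" "components H \<noteq> {}"
    using components_eq_component_at[OF hyper] hyper by (auto simp: is_hypergraph_def)
  then have "0 < card (components H)" by (simp add: card_gt_0_iff)
  then have "1 < card I"
    using cut bij_betw_same_card[OF enum] by (simp add: cut_edge_def num_components_def)
  then have "\<not> I \<subseteq> {i}"
    using card_mono[of "{i}" I] by auto
  then show ?thesis using that by blast
qed

text \<open>Otherwise no edge of \<open>H\<close> would leave the component, contrary to the connectedness of \<open>H\<close>.\<close>
lemma cut_edge_meets_component:
  assumes "i \<in> I"
  shows "incidence H f \<inter> V i \<noteq> {}"
proof
  assume empty: "incidence H f \<inter> V i = {}"
  obtain j where j: "j \<in> I" "j \<noteq> i" by (rule other_component)
  obtain u w where u: "u \<in> V i" and w: "w \<in> V j"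
    using component_nonempty assms j(1) by blast
  have "(u, w) \<in> linked H"
    using conn u w component_verts_subset assms j(1)
    unfolding connected_hypergraph_iff_linked[OF hyper] by blast
  then have "w \<in> V i"
    using u
  proof (rule linked_closed_set)
    fix e assume "e \<in> edges H" "incidence H e \<inter> V i \<noteq> {}"
    then show "incidence H e \<subseteq> V i"
      using empty edge_within_component[OF assms] by blast
  qed
  then show False using component_verts_disjoint assms j w by blast
qed

lemma closed_strict_trail_in_one_component:
  assumes "strict_trail H T" "closed_walk T"
  obtains i where "i \<in> I" "walk_anchors T \<subseteq> V i"
proof -
  have walk: "is_walk H T" using assms(1) by (simp add: strict_trail_def)
  obtain u where u: "u \<in> walk_anchors T" using walk_anchors_nonempty[OF walk] by auto
  then obtain i where i: "i \<in> I" "u \<in> V i"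
    using component_verts_cover walk_anchors_subset[OF walk] by blast
  have "walk_anchors T \<subseteq> V i"
    using component_verts_linked[OF i] walk_anchors_subset[OF walk]
      closed_strict_trail_linked_without_edge[OF assms u] by blast
  then show ?thesis using that i by blast
qed

text \<open>
  A trail of \<open>H\<close> with anchors in a vertex set survives the restriction to that set: each edge that it
  traverses meets the set and keeps the anchors at which it is used.  The edge \<open>f\<close> may be among the
  traversed ones here; excluding it yields exactly the trails of the component.
\<close>
lemma strict_trail_induced_iff:
  assumes "i \<in> I"
  shows "strict_trail (induced H (V i)) T \<longleftrightarrow> strict_trail H T \<and> walk_anchors T \<subseteq> V i"
proof -
  obtain vs es where T: "T = (vs, es)" by (cases T)
  have meets: "incidence H e \<inter> V i \<noteq> {}"
    if "is_walk H T" "walk_anchors T \<subseteq> V i" "e \<in> set es" for e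
    using walk_edge_meets_anchors[OF that(1), of e] that(2,3) T by (auto simp: walk_edges_def)
  have nth: "vs ! k \<in> V i" "vs ! Suc k \<in> V i"
    if "length vs = Suc (length es)" "set vs \<subseteq> V i" "k < length es" for k
    using that by (auto simp: subset_iff)
  show ?thesis
    using component_verts_subset[OF assms] meets nth
    unfolding T strict_trail_def is_walk_def induced_def walk_anchors_def
    by (auto simp: subset_iff)
qed

lemma strict_trail_component_iff:
  assumes "i \<in> I"
  shows "strict_trail (C i) T \<longleftrightarrow>
    strict_trail H T \<and> walk_anchors T \<subseteq> V i \<and> f \<notin> walk_edges T"
proof -
  obtain vs es where T: "T = (vs, es)" by (cases T)
  have meets: "incidence H e \<inter> V i \<noteq> {}"
    if "is_walk H T" "walk_anchors T \<subseteq> V i" "e \<in> set es" for e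
    using walk_edge_meets_anchors[OF that(1), of e] that(2,3) T by (auto simp: walk_edges_def)
  show ?thesis
    using component_verts_subset[OF assms] meets
    unfolding T strict_trail_def is_walk_def walk_anchors_def walk_edges_def
      component_edges[OF assms] component_incidence[OF assms]
    by (auto simp: subset_iff)
qed

lemma traversed_edge_meets_component:
  assumes "strict_trail H T" "walk_anchors T \<subseteq> V i" "e \<in> walk_edges T"
  shows "e \<in> edges H" "incidence H e \<inter> V i \<noteq> {}"
  using walk_edge_meets_anchors[of H T e] walk_edges_subset[of H T] assms
  by (auto simp: strict_trail_def)

lemma edge_meets_unique_component:
  assumes "i \<in> I" "j \<in> I" "e \<in> edges H" "e \<noteq> f"
    and "incidence H e \<inter> V i \<noteq> {}" "incidence H e \<inter> V j \<noteq> {}"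
  shows "i = j"
  using edge_within_component[OF assms(1,3,4,5)] component_verts_disjoint[OF assms(1,2)] assms(6)
  by blast

section \<open>Euler families\<close>

definition trails_in :: "('v, 'e) walk set \<Rightarrow> 'i \<Rightarrow> ('v, 'e) walk set" where
  "trails_in F i = {T \<in> F. walk_anchors T \<subseteq> V i}"

lemma euler_family_home:
  assumes "euler_family H F" "T \<in> F"
  obtains i where "i \<in> I" "T \<in> trails_in F i"
  using assms closed_strict_trail_in_one_component[of T]
  by (auto simp: euler_family_def trails_in_def)

text \<open>
  The component \<open>i\<close> is the one that contains the anchors of the unique trail of \<open>F\<close> through \<open>f\<close>.
  An edge other than \<open>f\<close> that meets a component is traversed by a trail of that same component, so
  the sorted subfamilies cover all edges they should.
\<close>
lemma euler_family_split:
  assumes F: "euler_family H F"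
  obtains i where "i \<in> I" "euler_family (induced H (V i)) (trails_in F i)" "trails_in F i \<noteq> {}"
    and "\<And>j. j \<in> I \<Longrightarrow> j \<noteq> i \<Longrightarrow> euler_family (C j) (trails_in F j)"
proof -
  have trail: "strict_trail H T" "closed_walk T" "\<not> trivial_walk T" if "T \<in> F" for T
    using F that by (auto simp: euler_family_def)
  have edisj: "pairwise (\<lambda>S T. disjnt (walk_edges S) (walk_edges T)) F"
    and adisj: "pairwise (\<lambda>S T. disjnt (walk_anchors S) (walk_anchors T)) F"
    and cover: "(\<Union>T\<in>F. walk_edges T) = edges H"
    using F by (auto simp: euler_family_def)
  have sub: "trails_in F j \<subseteq> F" for j unfolding trails_in_def by blast
  obtain T0 where T0: "T0 \<in> F" "f \<in> walk_edges T0" using f_edge cover by blast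
  then obtain i where i: "i \<in> I" "T0 \<in> trails_in F i" using euler_family_home[OF F] by blast
  have f_only: "T = T0" if "T \<in> F" "f \<in> walk_edges T" for T
    using edisj that T0 by (auto simp: pairwise_def disjnt_iff)
  have traversed: "\<exists>T\<in>trails_in F j. e \<in> walk_edges T"
    if e: "j \<in> I" "e \<in> edges H" "e \<noteq> f" "incidence H e \<inter> V j \<noteq> {}" for e j
  proof -
    obtain T where T: "T \<in> F" "e \<in> walk_edges T" using e(2) cover by blast
    obtain k where k: "k \<in> I" "T \<in> trails_in F k" using euler_family_home[OF F T(1)] by blast
    have "incidence H e \<inter> V k \<noteq> {}"
      using traversed_edge_meets_component(2)[of T k e] trail(1) T k by (auto simp: trails_in_def)
    then have "k = j" using edge_meets_unique_component[OF k(1) e(1-3)] e(4) by blast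
    then show ?thesis using k T(2) by blast
  qed
  have f_home: "f \<notin> walk_edges T" if "j \<in> I" "j \<noteq> i" "T \<in> trails_in F j" for j T
  proof
    assume "f \<in> walk_edges T"
    then have "T0 \<in> trails_in F j" using f_only[of T] that(3) sub by blast
    then have "walk_anchors T0 \<subseteq> V i \<inter> V j" using i(2) by (auto simp: trails_in_def)
    moreover have "walk_anchors T0 \<noteq> {}"
      using walk_anchors_nonempty[of H T0] trail(1) T0(1) by (auto simp: strict_trail_def)
    ultimately show False using component_verts_disjoint[OF i(1) that(1)] that(2) by blast
  qed
  have meets: "e \<in> edges H" "incidence H e \<inter> V j \<noteq> {}"
    if "T \<in> trails_in F j" "e \<in> walk_edges T" for T j e
    using traversed_edge_meets_component[of T j e] trail(1) that by (auto simp: trails_in_def)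
  have "(\<Union>T\<in>trails_in F i. walk_edges T) = {e \<in> edges H. incidence H e \<inter> V i \<noteq> {}}"
  proof (intro equalityI subsetI)
    fix e assume "e \<in> {e \<in> edges H. incidence H e \<inter> V i \<noteq> {}}"
    then show "e \<in> (\<Union>T\<in>trails_in F i. walk_edges T)"
      using traversed[OF i(1), of e] i(2) T0(2) by (cases "e = f") auto
  qed (use meets in auto)
  moreover have "strict_trail (induced H (V i)) T" if "T \<in> trails_in F i" for T
    using trail(1)[of T] that strict_trail_induced_iff[OF i(1)] by (simp add: trails_in_def)
  moreover have "edges (induced H (V i)) = {e \<in> edges H. incidence H e \<inter> V i \<noteq> {}}"
    by (simp add: induced_def)
  ultimately have "euler_family (induced H (V i)) (trails_in F i)"
    using trail(2,3) pairwise_subset[OF edisj sub] pairwise_subset[OF adisj sub]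
    unfolding euler_family_def by (simp add: subsetD[OF sub])
  moreover have "euler_family (C j) (trails_in F j)" if j: "j \<in> I" "j \<noteq> i" for j
  proof -
    have "(\<Union>T\<in>trails_in F j. walk_edges T) = edges (C j)"
      unfolding component_edges[OF j(1)]
    proof (intro equalityI subsetI)
      fix e assume "e \<in> {e \<in> edges H - {f}. incidence H e \<inter> V j \<noteq> {}}"
      then show "e \<in> (\<Union>T\<in>trails_in F j. walk_edges T)"
        using traversed[OF j(1), of e] by auto
    next
      fix e assume "e \<in> (\<Union>T\<in>trails_in F j. walk_edges T)"
      then obtain T where T: "T \<in> trails_in F j" "e \<in> walk_edges T" by blast
      then have "e \<noteq> f" using f_home[OF j T(1)] by auto
      then show "e \<in> {e \<in> edges H - {f}. incidence H e \<inter> V j \<noteq> {}}"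
        using meets[OF T] by simp
    qed
    moreover have "strict_trail (C j) T" if "T \<in> trails_in F j" for T
      using trail(1)[of T] that f_home[OF j that] strict_trail_component_iff[OF j(1)]
      by (simp add: trails_in_def)
    ultimately show ?thesis
      using trail(2,3) pairwise_subset[OF edisj sub] pairwise_subset[OF adisj sub]
      unfolding euler_family_def by (simp add: subsetD[OF sub])
  qed
  ultimately show ?thesis using that i by blast
qed

lemma spanning_split:
  assumes "euler_family H F" "(\<Union>T\<in>F. walk_anchors T) = verts H" "j \<in> I"
  shows "(\<Union>T\<in>trails_in F j. walk_anchors T) = V j"
proof (intro equalityI subsetI)
  fix v assume v: "v \<in> V j"
  then have "v \<in> verts H" using component_verts_subset assms(3) by blast
  then obtain T where T: "T \<in> F" "v \<in> walk_anchors T" using assms(2) by blast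
  obtain k where k: "k \<in> I" "T \<in> trails_in F k" using euler_family_home[OF assms(1) T(1)] by blast
  then have "v \<in> V k" using T(2) by (auto simp: trails_in_def)
  then have "k = j" using component_verts_disjoint[OF k(1) assms(3)] v by blast
  then show "v \<in> (\<Union>T\<in>trails_in F j. walk_anchors T)" using k T(2) by blast
qed (auto simp: trails_in_def)

text \<open>
  Families of different components share no anchors, and no edges either: an edge other than \<open>f\<close>
  meets only one component, and \<open>f\<close> is available only at \<open>i\<close>.  As no edge is empty, every edge meets
  some component, and the family of that component covers it; the edge \<open>f\<close> meets all components,
  hence also \<open>i\<close>, the one whose family can traverse it.
\<close>
lemma euler_family_merge:
  assumes ne: "no_empty_edges H" and i: "i \<in> I"
    and at_i: "euler_family (induced H (V i)) (F i)"
    and at_j: "\<And>j. j \<in> I \<Longrightarrow> j \<noteq> i \<Longrightarrow> euler_family (C j) (F j)"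
  shows "euler_family H (\<Union>j\<in>I. F j)"
proof -
  have trail: "strict_trail H T \<and> closed_walk T \<and> \<not> trivial_walk T \<and> walk_anchors T \<subseteq> V j"
    if "j \<in> I" "T \<in> F j" for j T
    using at_i at_j[OF that(1)] that(2) strict_trail_induced_iff[OF i]
      strict_trail_component_iff[OF that(1)]
    by (cases "j = i") (auto simp: euler_family_def)
  have no_f: "f \<notin> walk_edges T" if "j \<in> I" "j \<noteq> i" "T \<in> F j" for j T
    using at_j[OF that(1,2)] that(3) strict_trail_component_iff[OF that(1)]
    by (auto simp: euler_family_def)
  have local_disjoint: "pairwise (\<lambda>S T. disjnt (walk_edges S) (walk_edges T)) (F j)"
    "pairwise (\<lambda>S T. disjnt (walk_anchors S) (walk_anchors T)) (F j)" if "j \<in> I" for j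
    using at_i at_j[OF that] by (cases "j = i"; simp add: euler_family_def)+
  have same_edge: "j = k" if jk: "j \<in> I" "k \<in> I" "S \<in> F j" "T \<in> F k"
    "e \<in> walk_edges S" "e \<in> walk_edges T" for j k S T e
  proof (cases "e = f")
    case True
    then show ?thesis using no_f jk by metis
  next
    case False
    have S: "strict_trail H S" "walk_anchors S \<subseteq> V j" using trail jk(1,3) by auto
    have T: "strict_trail H T" "walk_anchors T \<subseteq> V k" using trail jk(2,4) by auto
    show ?thesis
      using edge_meets_unique_component[OF jk(1,2) _ False]
        traversed_edge_meets_component[OF S jk(5)] traversed_edge_meets_component[OF T jk(6)]
      by simp
  qed
  have same_anchor: "j = k" if "j \<in> I" "k \<in> I" "S \<in> F j" "T \<in> F k"
    "v \<in> walk_anchors S" "v \<in> walk_anchors T" for j k S T v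
    using component_verts_disjoint[OF that(1,2), of v] trail[OF that(1,3)] trail[OF that(2,4)]
      that(5,6) by (simp add: subset_iff)
  have edges_disjoint: "pairwise (\<lambda>S T. disjnt (walk_edges S) (walk_edges T)) (\<Union>j\<in>I. F j)"
    using local_disjoint(1) same_edge by (rule pairwise_disjnt_UN)
  have anchors_disjoint: "pairwise (\<lambda>S T. disjnt (walk_anchors S) (walk_anchors T)) (\<Union>j\<in>I. F j)"
    using local_disjoint(2) same_anchor by (rule pairwise_disjnt_UN)
  have covered: "e \<in> (\<Union>T\<in>(\<Union>j\<in>I. F j). walk_edges T)" if e: "e \<in> edges H" for e
  proof -
    have cover_i: "e \<in> (\<Union>T\<in>F i. walk_edges T)" if "incidence H e \<inter> V i \<noteq> {}"
      using at_i e that by (simp add: euler_family_def induced_def)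
    show ?thesis
    proof (cases "e = f")
      case True
      then show ?thesis using cut_edge_meets_component[OF i] cover_i i by blast
    next
      case False
      obtain v where "v \<in> incidence H e" "v \<in> verts H"
        using ne e hyper by (fastforce simp: no_empty_edges_def is_hypergraph_def)
      then obtain j where j: "j \<in> I" "incidence H e \<inter> V j \<noteq> {}"
        using component_verts_cover by blast
      show ?thesis
      proof (cases "j = i")
        case True
        then show ?thesis using cover_i i j by blast
      next
        case False
        have "e \<in> edges (C j)" using e \<open>e \<noteq> f\<close> j component_edges by auto
        then have "e \<in> (\<Union>T\<in>F j. walk_edges T)"
          using at_j[OF j(1) False] by (simp add: euler_family_def)
        then show ?thesis using j(1) by blast
      qed
    qed
  qed
  have "walk_edges T \<subseteq> edges H" if "j \<in> I" "T \<in> F j" for j T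
    using trail[OF that] walk_edges_subset[of H T] by (simp add: strict_trail_def)
  then have "(\<Union>T\<in>(\<Union>j\<in>I. F j). walk_edges T) \<subseteq> edges H"
    by (intro UN_least) (elim UN_E)
  then have "(\<Union>T\<in>(\<Union>j\<in>I. F j). walk_edges T) = edges H"
    using covered by (meson subsetI subset_antisym)
  moreover have "\<forall>T\<in>(\<Union>j\<in>I. F j). strict_trail H T \<and> closed_walk T \<and> \<not> trivial_walk T"
    using trail by simp
  ultimately show ?thesis
    using edges_disjoint anchors_disjoint unfolding euler_family_def by simp
qed

lemma euler_family_iff:
  assumes "no_empty_edges H"
  shows "(\<exists>F. euler_family H F) \<longleftrightarrow>
    (\<exists>i\<in>I. (\<exists>F. euler_family (induced H (V i)) F \<and> F \<noteq> {}) \<and>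
      (\<forall>j\<in>I. j \<noteq> i \<longrightarrow> (\<exists>F. euler_family (C j) F)))"
    (is "?L \<longleftrightarrow> ?R")
proof
  assume ?L
  then show ?R using euler_family_split by metis
next
  assume ?R
  then obtain i Fi F where i: "i \<in> I" "euler_family (induced H (V i)) Fi"
    and F: "\<And>j. j \<in> I \<Longrightarrow> j \<noteq> i \<Longrightarrow> euler_family (C j) (F j)" by metis
  have "euler_family H (\<Union>j\<in>I. (F(i := Fi)) j)"
    by (rule euler_family_merge[OF assms i(1)]) (use i F in auto)
  then show ?L by blast
qed

lemma spanning_euler_family_iff:
  assumes "no_empty_edges H"
  shows "(\<exists>F. spanning_euler_family H F) \<longleftrightarrow>
    (\<exists>i\<in>I. (\<exists>F. spanning_euler_family (induced H (V i)) F \<and> F \<noteq> {}) \<and>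
      (\<forall>j\<in>I. j \<noteq> i \<longrightarrow> (\<exists>F. spanning_euler_family (C j) F)))"
    (is "?L \<longleftrightarrow> ?R")
proof
  assume ?L
  then obtain F where F: "euler_family H F" "(\<Union>T\<in>F. walk_anchors T) = verts H"
    by (auto simp: spanning_euler_family_def)
  obtain i where i: "i \<in> I" "euler_family (induced H (V i)) (trails_in F i)" "trails_in F i \<noteq> {}"
    and j: "\<And>j. j \<in> I \<Longrightarrow> j \<noteq> i \<Longrightarrow> euler_family (C j) (trails_in F j)"
    using euler_family_split[OF F(1)] by blast
  have "spanning_euler_family (induced H (V i)) (trails_in F i)"
    using i spanning_split[OF F i(1)] by (simp add: spanning_euler_family_def induced_def)
  moreover have "spanning_euler_family (C k) (trails_in F k)" if "k \<in> I" "k \<noteq> i" for k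
    using j[OF that] spanning_split[OF F that(1)] by (simp add: spanning_euler_family_def)
  ultimately show ?R using i by blast
next
  assume ?R
  then obtain i Fi F where i: "i \<in> I" "spanning_euler_family (induced H (V i)) Fi"
    and F: "\<And>j. j \<in> I \<Longrightarrow> j \<noteq> i \<Longrightarrow> spanning_euler_family (C j) (F j)" by metis
  define F' where "F' = F(i := Fi)"
  have at_i: "spanning_euler_family (induced H (V i)) (F' i)"
    and at_j: "\<And>j. j \<in> I \<Longrightarrow> j \<noteq> i \<Longrightarrow> spanning_euler_family (C j) (F' j)"
    using i F by (simp_all add: F'_def)
  have "euler_family H (\<Union>j\<in>I. F' j)"
    using assms i(1)
  proof (rule euler_family_merge)
    show "euler_family (induced H (V i)) (F' i)"
      using at_i by (simp add: spanning_euler_family_def)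
    show "euler_family (C j) (F' j)" if "j \<in> I" "j \<noteq> i" for j
      using at_j[OF that] by (simp add: spanning_euler_family_def)
  qed
  moreover have "(\<Union>T\<in>(\<Union>j\<in>I. F' j). walk_anchors T) = verts H"
  proof -
    have "(\<Union>T\<in>F' j. walk_anchors T) = V j" if "j \<in> I" for j
      using at_i at_j[OF that]
      by (cases "j = i") (simp_all add: spanning_euler_family_def induced_def)
    then have "(\<Union>T\<in>(\<Union>j\<in>I. F' j). walk_anchors T) = (\<Union>j\<in>I. V j)"
      by (simp add: UN_UN_flatten)
    also have "\<dots> = verts H"
    proof (intro equalityI subsetI)
      fix v assume "v \<in> verts H"
      then show "v \<in> (\<Union>j\<in>I. V j)" using component_verts_cover by simp
    next
      fix v assume "v \<in> (\<Union>j\<in>I. V j)"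
      then obtain j where "j \<in> I" "v \<in> V j" by (rule UN_E)
      then show "v \<in> verts H" using component_verts_subset by (simp add: subset_iff)
    qed
    finally show ?thesis .
  qed
  ultimately have "spanning_euler_family H (\<Union>j\<in>I. F' j)"
    unfolding spanning_euler_family_def by simp
  then show ?L by (rule exI)
qed

section \<open>Euler tours\<close>

lemma euler_tour_iff:
  assumes "no_empty_edges H"
  shows "(\<exists>T. euler_tour H T) \<longleftrightarrow>
    (\<exists>i\<in>I. (\<exists>T. euler_tour (induced H (V i)) T) \<and> (\<forall>j\<in>I. j \<noteq> i \<longrightarrow> edges (C j) = {}))"
    (is "?L \<longleftrightarrow> ?R")
proof
  assume ?L
  then obtain T where T: "strict_trail H T" "closed_walk T" "walk_edges T = edges H"
    by (auto simp: euler_tour_def)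
  obtain i where i: "i \<in> I" "walk_anchors T \<subseteq> V i"
    using closed_strict_trail_in_one_component[OF T(1,2)] by blast
  have meets: "incidence H e \<inter> V i \<noteq> {}" if "e \<in> edges H" for e
    using traversed_edge_meets_component(2)[OF T(1) i(2)] that T(3) by blast
  then have "euler_tour (induced H (V i)) T"
    using T i strict_trail_induced_iff[OF i(1)] by (auto simp: euler_tour_def induced_def)
  moreover have "edges (C j) = {}" if "j \<in> I" "j \<noteq> i" for j
    using meets edge_meets_unique_component[OF i(1) that(1)] that(2)
    unfolding component_edges[OF that(1)] by blast
  ultimately show ?R using i by blast
next
  assume ?R
  then obtain i T where i: "i \<in> I" and T: "euler_tour (induced H (V i)) T"
    and empty: "\<And>j. j \<in> I \<Longrightarrow> j \<noteq> i \<Longrightarrow> edges (C j) = {}" by blast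
  have "incidence H e \<inter> V i \<noteq> {}" if e: "e \<in> edges H" for e
  proof (cases "e = f")
    case True
    then show ?thesis using cut_edge_meets_component[OF i] by simp
  next
    case False
    obtain v where "v \<in> incidence H e" "v \<in> verts H"
      using assms e hyper by (fastforce simp: no_empty_edges_def is_hypergraph_def)
    then obtain j where j: "j \<in> I" "incidence H e \<inter> V j \<noteq> {}"
      using component_verts_cover by blast
    have "e \<in> edges (C j)" using e False j component_edges[OF j(1)] by simp
    then have "j = i" using empty[OF j(1)] by auto
    then show ?thesis using j(2) by simp
  qed
  then have "edges (induced H (V i)) = edges H" by (auto simp: induced_def)
  then have "euler_tour H T"
    using T strict_trail_induced_iff[OF i] by (simp add: euler_tour_def)
  then show ?L by (rule exI)
qed

lemma no_spanning_euler_tour: "\<not> spanning_euler_tour H T"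
proof
  assume "spanning_euler_tour H T"
  then have T: "strict_trail H T" "closed_walk T" "walk_anchors T = verts H"
    by (auto simp: spanning_euler_tour_def euler_tour_def)
  obtain i where i: "i \<in> I" "verts H \<subseteq> V i"
    using closed_strict_trail_in_one_component[OF T(1,2)] unfolding T(3) by blast
  obtain j where j: "j \<in> I" "j \<noteq> i" by (rule other_component)
  then obtain v where v: "v \<in> V j" using component_nonempty by auto
  then have "v \<in> V i" using component_verts_subset[OF j(1)] i(2) by (simp add: subset_iff)
  then show False using component_verts_disjoint[OF i(1) j(1) _ v] j(2) by simp
qed

end

theorem theorem7p5p1:
  fixes H :: "('v, 'e) hypergraph" and f :: 'e
    and I :: "'i set" and C :: "'i \<Rightarrow> ('v, 'e) hypergraph"
  assumes "is_hypergraph H"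
    and "connected_hypergraph H"
    and "cut_edge H f"
    and "bij_betw C I (components (delete_edge H f))"
  shows
    "(no_empty_edges H \<longrightarrow>
        ((\<exists>F. euler_family H F) \<longleftrightarrow>
           (\<exists>i\<in>I. (\<exists>F. euler_family (induced H (verts (C i))) F \<and> F \<noteq> {}) \<and>
              (\<forall>j\<in>I. j \<noteq> i \<longrightarrow> (\<exists>F. euler_family (C j) F)))) \<and>
        ((\<exists>F. spanning_euler_family H F) \<longleftrightarrow>
           (\<exists>i\<in>I. (\<exists>F. spanning_euler_family (induced H (verts (C i))) F \<and> F \<noteq> {}) \<and>
              (\<forall>j\<in>I. j \<noteq> i \<longrightarrow> (\<exists>F. spanning_euler_family (C j) F)))) \<and>
        ((\<exists>T. euler_tour H T) \<longleftrightarrow>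
           (\<exists>i\<in>I. (\<exists>T. euler_tour (induced H (verts (C i))) T) \<and>
              (\<forall>j\<in>I. j \<noteq> i \<longrightarrow> edges (C j) = {})))) \<and>
     \<not> (\<exists>T. spanning_euler_tour H T)"
proof -
  interpret connected_with_cut_edge H f I C
    using assms by unfold_locales
  show ?thesis
    by (intro conjI impI euler_family_iff spanning_euler_family_iff euler_tour_iff)
      (simp_all add: no_spanning_euler_tour)
qed

end
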